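(* If $T$ is an $n$-vertex tree of diameter at most $4$, then $a_u(T)\le \sqrt{n-1}\le \Delta(T)$. Equality holds in the first inequality only when $n-1$ is a square and $T$ is the tree of diameter $4$ such that the central vertex and all its neighbors have degree $\sqrt{n-1}$.
   Context: Graphs are finite, simple and undirected. The vertices of a graph carry nonnegative integer weights. A unit acquisition move transfers one unit of weight from a vertex $u$ of positive weight to a neighbor $v$ of $u$, under the condition that before the move the weight of $v$ is at least the weight of $u$. The unit acquisition number $a_u(G)$ of a graph $G$ is the minimum size to which the set of vertices with positive weight can be reduced via successive unit acquisition moves, starting from the configuration in which every vertex has weight $1$. $\Delta(T)$ denotes the maximum vertex degree of $T$. The central vertex of a tree of diameter $4$ is its unique vertex having distance at most $2$ from every vertex.
   Formalization: The first inequality is stated only for n ≥ 2, since the one-vertex tree has a_u = 1 > 0; the equality description excludes n = 2, since the single edge attains equality but has diameter 1. *)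

theory Defs
  imports "Graph_Theory.Graph_Theory"
begin

text \<open>
  A finite simple undirected graph is a \<open>graph\<close> of the Graph_Theory entry: a finite symmetric
  digraph without loops and parallel arcs, so that \<open>out_degree\<close> is the usual vertex degree.
  The entry's \<^const>\<open>tree\<close> is not usable here: it also counts \<open>u, v, u\<close> as a cycle, hence no
  symmetric digraph with an arc satisfies it. Undirected cycles are the \<open>cycle\<close>s with at
  least three arcs.
\<close>

definition undirected_tree :: "('a, 'b) pre_digraph \<Rightarrow> bool" where
  "undirected_tree G \<longleftrightarrow>
     graph G \<and> connected G \<and> \<not> (\<exists>p. pre_digraph.cycle G p \<and> length p \<ge> 3)"

text \<open>With unit arc costs, the cost of a walk is its number of arcs.\<close>

definition graph_dist :: "('a, 'b) pre_digraph \<Rightarrow> 'a \<Rightarrow> 'a \<Rightarrow> ereal" where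
  "graph_dist G = wf_digraph.\<mu> G (\<lambda>_. 1)"

definition graph_diameter :: "('a, 'b) pre_digraph \<Rightarrow> ereal" where
  "graph_diameter G = (SUP u\<in>verts G. SUP v\<in>verts G. graph_dist G u v)"

definition max_degree :: "('a, 'b) pre_digraph \<Rightarrow> nat" where
  "max_degree G = Max (out_degree G ` verts G)"

definition central_vertex :: "('a, 'b) pre_digraph \<Rightarrow> 'a \<Rightarrow> bool" where
  "central_vertex G c \<longleftrightarrow>
     (\<forall>x. (x \<in> verts G \<and> (\<forall>v\<in>verts G. graph_dist G x v \<le> 2)) \<longleftrightarrow> x = c)"

definition unit_acquisition_move ::
  "('a, 'b) pre_digraph \<Rightarrow> ('a \<Rightarrow> nat) \<Rightarrow> ('a \<Rightarrow> nat) \<Rightarrow> bool" where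
  "unit_acquisition_move G w w' \<longleftrightarrow>
     (\<exists>u v. u \<rightarrow>\<^bsub>G\<^esub> v \<and> 0 < w u \<and> w u \<le> w v \<and> w' = w(u := w u - 1, v := w v + 1))"

text \<open>The weights of elements outside \<open>verts G\<close> are never changed and not counted.\<close>

definition unit_acquisition_number :: "('a, 'b) pre_digraph \<Rightarrow> nat" where
  "unit_acquisition_number G =
     (LEAST k. \<exists>w. (unit_acquisition_move G)\<^sup>*\<^sup>* (\<lambda>_. 1) w \<and> card {v \<in> verts G. 0 < w v} = k)"

end

theory Submission
  imports Defs
begin

text \<open>
  A tree of diameter at most 4 has a vertex \<open>c\<close> within distance 2 of every vertex. Removing \<open>c\<close>
  splits the rest into one branch per neighbour \<open>v\<close> of \<open>c\<close>, and that branch, consisting of \<open>v\<close>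
  and its neighbours other than \<open>c\<close>, has exactly \<open>deg v\<close> vertices. Hence \<open>n - 1\<close> is the sum of
  \<open>deg v\<close> over the neighbours \<open>v\<close> of \<open>c\<close> (\<open>card_verts_eq\<close>); the sum has \<open>deg c\<close> terms, each at
  most the maximum degree, which gives \<open>n - 1 \<le> \<Delta>\<^sup>2\<close>.

  Two strategies bound the unit acquisition number. Letting every vertex outside the
  neighbourhood of \<open>c\<close> move its unit to an adjacent neighbour of \<open>c\<close> leaves weight only on the
  neighbours of \<open>c\<close>, at most \<open>deg c\<close> vertices. Alternatively, some neighbour \<open>v\<close> is sacrificed: it
  moves its unit to \<open>c\<close>, and once \<open>c\<close> has weight 2 each other branch can be emptied into \<open>c\<close>
  one leaf at a time, since its root never has to grow beyond weight 2. What remains lies on \<open>c\<close>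
  and the leaves behind \<open>v\<close>, that is, on the \<open>deg v\<close> neighbours of \<open>v\<close>. So the acquisition number
  \<open>a\<close> is at most \<open>deg c\<close> and at most every \<open>deg v\<close>, and \<open>a\<^sup>2\<close> is at most the sum of the
  \<open>deg v\<close>, that is \<open>n - 1\<close>. In case of equality no term can exceed \<open>a\<close> and \<open>deg c = a\<close>;
  if moreover \<open>n \<noteq> 2\<close> then \<open>a \<ge> 2\<close>, so leaves in two different branches are at distance 4 and
  \<open>c\<close> is the only vertex of eccentricity at most 2.

  All metric facts about trees rest on \<open>unique_lower_neighbour\<close>: seen from any vertex \<open>r\<close>, a vertex
  has at most one neighbour that is not farther away from \<open>r\<close> than itself. Consequently a walk that
  does not turn back and has once moved away from \<open>r\<close> keeps moving away (\<open>hops_ascend\<close>), and the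
  arguments consist of choosing the right vertices \<open>r\<close>.
\<close>

section \<open>Distance as a natural number\<close>

definition (in pre_digraph) hops :: "'a \<Rightarrow> 'a \<Rightarrow> nat" where
  "hops u v = (LEAST k. \<exists>p. awalk u p v \<and> length p = k)"

definition (in pre_digraph) neighbours :: "'a \<Rightarrow> 'a set" where
  "neighbours v = {w. v \<rightarrow>\<^bsub>G\<^esub> w}"

context wf_digraph
begin

lemma hops_le_length: "awalk u p v \<Longrightarrow> hops u v \<le> length p"
  unfolding hops_def by (rule Least_le) blast

lemma shortest_walk:
  assumes "u \<rightarrow>\<^sup>* v"
  obtains p where "awalk u p v" "length p = hops u v"
proof -
  from assms obtain p where "awalk u p v" by (auto simp: reachable_awalk)
  then have "\<exists>p. awalk u p v \<and> length p = hops u v"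
    unfolding hops_def using LeastI_ex[of "\<lambda>k. \<exists>p. awalk u p v \<and> length p = k"] by blast
  then show thesis using that by blast
qed

lemma graph_dist_eq_hops:
  assumes "u \<rightarrow>\<^sup>* v"
  shows "graph_dist G u v = ereal (real (hops u v))"
proof -
  have cost: "awalk_cost (\<lambda>_. 1) p = real (length p)" for p :: "'b list"
    by (induct p) auto
  obtain p where "awalk u p v" "length p = hops u v"
    using shortest_walk[OF assms] .
  then have "\<mu> (\<lambda>_. 1) u v \<le> ereal (real (hops u v))"
    using min_cost_le_walk_cost[of u p v "\<lambda>_. 1"] by (simp add: cost)
  moreover have "ereal (real (hops u v)) \<le> \<mu> (\<lambda>_. 1) u v"
    unfolding \<mu>_def by (rule INF_greatest) (auto simp: cost dest: hops_le_length)
  ultimately show ?thesis unfolding graph_dist_def by (rule antisym)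
qed

lemma hops_self [simp]: "u \<in> verts G \<Longrightarrow> hops u u = 0"
  using hops_le_length[OF awalk_Nil_iff[THEN iffD2], of u u] by simp

lemma hops_eq_0_iff:
  assumes "u \<rightarrow>\<^sup>* v"
  shows "hops u v = 0 \<longleftrightarrow> u = v"
proof
  assume "hops u v = 0"
  moreover obtain p where "awalk u p v" "length p = hops u v"
    using shortest_walk[OF assms] .
  ultimately show "u = v" by auto
next
  assume "u = v"
  then show "hops u v = 0" using assms by (auto dest: reachable_in_verts)
qed

lemma walk_of_adj:
  assumes "u \<rightarrow>\<^bsub>G\<^esub> v"
  obtains e where "awalk u [e] v"
proof -
  from assms obtain e where "e \<in> arcs G" "tail G e = u" "head G e = v" by (rule reachableE)
  then show thesis using that arc_implies_awalk by blast
qed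

lemma hops_step_le:
  assumes "r \<rightarrow>\<^sup>* y" "y \<rightarrow>\<^bsub>G\<^esub> z"
  shows "hops r z \<le> hops r y + 1"
proof -
  obtain p where p: "awalk r p y" "length p = hops r y" using shortest_walk[OF assms(1)] .
  obtain e where "awalk y [e] z" using walk_of_adj[OF assms(2)] .
  with p(1) have "awalk r (p @ [e]) z" by (rule awalk_appendI)
  from hops_le_length[OF this] show ?thesis using p(2) by simp
qed

lemma hops_parent:
  assumes "r \<rightarrow>\<^sup>* v" "v \<noteq> r"
  obtains u where "u \<rightarrow>\<^bsub>G\<^esub> v" "hops r v = hops r u + 1"
proof -
  obtain p where p: "awalk r p v" "length p = hops r v" using shortest_walk[OF assms(1)] .
  with assms(2) obtain q e where q: "p = q @ [e]"
    by (cases p rule: rev_cases) auto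
  with p(1) obtain u where u: "awalk r q u" "awalk u [e] v" by auto
  from u(2) have "u \<rightarrow>\<^bsub>G\<^esub> v" by (auto simp: awalk_Cons_iff awalk_Nil_iff arcs_ends_conv)
  moreover have "hops r u \<le> length q" using u(1) by (rule hops_le_length)
  moreover have "hops r v \<le> hops r u + 1"
    using hops_step_le[OF reachable_awalkI[OF u(1)] \<open>u \<rightarrow>\<^bsub>G\<^esub> v\<close>] .
  ultimately show thesis using that[of u] p(2) q by simp
qed

text \<open>
  Before reaching its end, a shortest walk from \<open>r\<close> visits only vertices closer to \<open>r\<close> than
  the end, so it cannot meet another vertex that is at least as far away.
\<close>

lemma shortest_walk_avoids:
  assumes "r \<rightarrow>\<^sup>* y" "hops r y \<le> hops r x" "y \<noteq> x"
  obtains p where "awalk r p y" "x \<notin> set (awalk_verts r p)"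
proof -
  obtain p where p: "awalk r p y" "length p = hops r y" using shortest_walk[OF assms(1)] .
  have "x \<notin> set (awalk_verts r p)"
  proof
    assume "x \<in> set (awalk_verts r p)"
    from awalk_decomp[OF p(1) this] obtain q s
      where qs: "p = q @ s" "awalk r q x" "awalk x s y" by blast
    have "length q + length s = hops r y" using p(2) qs(1) by simp
    with hops_le_length[OF qs(2)] assms(2) have "length s = 0" by linarith
    with qs(3) have "awalk x [] y" by simp
    with assms(3) show False by (simp add: awalk_Nil_iff)
  qed
  with p(1) show thesis using that by blast
qed

end

lemma (in sym_digraph) awalk_reverse:
  assumes "awalk u p v"
  shows "\<exists>q. awalk v q u \<and> length q = length p \<and> set (awalk_verts v q) = set (awalk_verts u p)"
  using assms
proof (induct p arbitrary: u)
  case Nil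
  then show ?case by (intro exI[of _ "[]"]) (auto simp: awalk_Nil_iff)
next
  case (Cons e p)
  then have e: "e \<in> arcs G" "tail G e = u" and p: "awalk (head G e) p v"
    by (auto simp: awalk_Cons_iff)
  from Cons(1)[OF p] obtain q where q: "awalk v q (head G e)" "length q = length p"
    "set (awalk_verts v q) = set (awalk_verts (head G e) p)" by blast
  from sym_arcs e(1) obtain e' where e': "e' \<in> arcs G" "tail G e' = head G e" "head G e' = u"
    using e(2) unfolding symmetric_conv by metis
  have w: "awalk (head G e) [e'] u" using arc_implies_awalk[OF e'(1)] e'(2,3) by simp
  have "set (awalk_verts v (q @ [e'])) = set (awalk_verts v q) \<union> {head G e, u}"
    using set_awalk_verts_append[OF q(1) w] e' by simp
  moreover have "head G e \<in> set (awalk_verts v q)" using q(1,3) p hd_in_awalk_verts(1) by simp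
  ultimately have "set (awalk_verts v (q @ [e'])) = set (awalk_verts u (e # p))"
    using q(3) e by auto
  moreover have "awalk v (q @ [e']) u" using q(1) w by (rule awalk_appendI)
  ultimately show ?case using q(2) by (intro exI[of _ "q @ [e']"]) simp
qed

lemma (in sym_digraph) hops_commute:
  assumes "u \<rightarrow>\<^sup>* v"
  shows "hops u v = hops v u"
proof -
  have le: "hops y x \<le> hops x y" if "x \<rightarrow>\<^sup>* y" for x y
    using shortest_walk[OF that] awalk_reverse hops_le_length by metis
  show ?thesis
    using le[OF assms] le[OF symmetric_reachable'[OF assms]] by simp
qed

section \<open>Metric structure of trees\<close>

locale finite_tree = graph G for G :: "('a, 'b) pre_digraph" (structure) +
  assumes connected_G: "connected G"
    and no_long_cycle: "\<not> (\<exists>p. cycle p \<and> length p \<ge> 3)"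
begin

lemma reach: "u \<in> verts G \<Longrightarrow> v \<in> verts G \<Longrightarrow> u \<rightarrow>\<^sup>* v"
  using symmetric_connected_imp_strongly_connected[OF sym_arcs connected_G] by auto

lemma verts_nonempty: "verts G \<noteq> {}"
  using symmetric_connected_imp_strongly_connected[OF sym_arcs connected_G]
  by (simp add: strongly_connected_def)

lemma adj_sym: "u \<rightarrow>\<^bsub>G\<^esub> v \<Longrightarrow> v \<rightarrow>\<^bsub>G\<^esub> u"
  using arcs_ends_symmetric[OF sym_arcs] .

text \<open>
  This is where the absence of cycles enters. Shortest walks from \<open>r\<close> to two such neighbours
  \<open>y\<close> and \<open>z\<close> of \<open>x\<close> avoid \<open>x\<close>. Joined at \<open>r\<close> and shortened to a path from \<open>y\<close> to \<open>z\<close>, they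
  close up through \<open>x\<close> to a cycle.
\<close>

lemma unique_lower_neighbour:
  assumes r: "r \<in> verts G" and adj: "x \<rightarrow>\<^bsub>G\<^esub> y" "x \<rightarrow>\<^bsub>G\<^esub> z"
    and le: "hops r y \<le> hops r x" "hops r z \<le> hops r x"
  shows "y = z"
proof (rule ccontr)
  assume "y \<noteq> z"
  have V: "x \<in> verts G" "y \<in> verts G" "z \<in> verts G" using adj by (auto dest: adj_in_verts)
  have "y \<noteq> x" "z \<noteq> x" using adj adj_not_same by blast+
  obtain p where p: "awalk r p y" "x \<notin> set (awalk_verts r p)"
    using shortest_walk_avoids[OF reach[OF r V(2)] le(1) \<open>y \<noteq> x\<close>] .
  obtain q where q: "awalk r q z" "x \<notin> set (awalk_verts r q)"
    using shortest_walk_avoids[OF reach[OF r V(3)] le(2) \<open>z \<noteq> x\<close>] .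
  obtain p' where p': "awalk y p' r" "x \<notin> set (awalk_verts y p')"
    using awalk_reverse[OF p(1)] p(2) by auto
  define s where "s = awalk_to_apath (p' @ q)"
  have pq: "awalk y (p' @ q) z" using p'(1) q(1) by (rule awalk_appendI)
  have avoid: "x \<notin> set (awalk_verts y (p' @ q))"
    using set_awalk_verts_append[OF p'(1) q(1)] p'(2) q(2) by simp
  have s: "apath y s z" unfolding s_def by (rule apath_awalk_to_apath[OF pq])
  then have sw: "awalk y s z" by (rule awalkI_apath)
  have "set (awalk_verts y s) \<subseteq> set (awalk_verts y (p' @ q))"
    unfolding set_awalk_verts[OF pq] set_awalk_verts[OF sw] set_map
    by (intro Un_mono image_mono order_refl awalk_to_apath_subset[OF pq, folded s_def])
  with avoid have "x \<notin> set (awalk_verts y s)" by blast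
  moreover have "s \<noteq> []" using sw \<open>y \<noteq> z\<close> by (metis awalk_Nil_iff)
  moreover obtain e where e: "awalk x [e] y" using walk_of_adj[OF adj(1)] .
  moreover obtain f where f: "awalk z [f] x" using walk_of_adj[OF adj_sym[OF adj(2)]] .
  have sf: "awalk y (s @ [f]) x" using sw f by (rule awalk_appendI)
  \<comment> \<open>The path \<open>s\<close> has at least one arc, so \<open>e\<close>, \<open>s\<close> and \<open>f\<close> together have at least three.\<close>
  have closed: "awalk x (e # s @ [f]) x" using awalk_appendI[OF e sf] by simp
  have "awalk_verts y (s @ [f]) = awalk_verts y s @ [x]"
    using awalk_verts_append[OF sf] f awalkE'[OF sw] by (simp add: awalk_Cons_iff awalk_Nil_iff)
  moreover have "tl (awalk_verts x (e # s @ [f])) = awalk_verts y (s @ [f])"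
    using e by (simp add: awalk_Cons_iff awalk_Nil_iff)
  moreover have "distinct (awalk_verts y s)" using s by (simp add: apath_def)
  ultimately have "distinct (tl (awalk_verts x (e # s @ [f])))" "length (e # s @ [f]) \<ge> 3"
    by (simp_all add: Suc_le_eq)
  with closed have "cycle (e # s @ [f]) \<and> length (e # s @ [f]) \<ge> 3"
    unfolding cycle_def by blast
  then show False using no_long_cycle by blast
qed

text \<open>
  The neighbour \<open>x\<close> already is the one neighbour of \<open>y\<close> that is not farther from \<open>r\<close> than \<open>y\<close>;
  every other neighbour of \<open>y\<close> must be one step farther.
\<close>

lemma hops_ascend:
  assumes "r \<in> verts G" "x \<rightarrow>\<^bsub>G\<^esub> y" "y \<rightarrow>\<^bsub>G\<^esub> z" "x \<noteq> z" "hops r x \<le> hops r y"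
  shows "hops r z = hops r y + 1"
proof -
  have "\<not> hops r z \<le> hops r y"
    using unique_lower_neighbour[OF assms(1) adj_sym[OF assms(2)] assms(3,5)] assms(4) by blast
  moreover have "hops r z \<le> hops r y + 1"
    using hops_step_le[OF reach[OF assms(1) adj_in_verts(1)[OF assms(3)]] assms(3)] .
  ultimately show ?thesis by simp
qed

text \<open>
  If all distances are at most 2, any vertex will do. Otherwise the centre is a middle vertex of a
  longest path \<open>u, x1, c, x3, \<dots>, v\<close>. From a vertex \<open>w\<close> at
  distance 3 or more from \<open>c\<close>, at most one of \<open>x1\<close> and \<open>x3\<close> lies nearer than \<open>c\<close>. Walking from
  \<open>c\<close> through the other one to the end of the path only increases the distance from \<open>w\<close>: it
  exceeds 4 at \<open>u\<close>, or the length of the longest path at \<open>v\<close>.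
\<close>

lemma exists_center:
  assumes le4: "\<And>u v. u \<in> verts G \<Longrightarrow> v \<in> verts G \<Longrightarrow> hops u v \<le> 4"
  obtains c where "c \<in> verts G" "\<And>w. w \<in> verts G \<Longrightarrow> hops c w \<le> 2"
proof -
  define H where "H = (\<lambda>(u, v). hops u v) ` (verts G \<times> verts G)"
  have H: "finite H" "H \<noteq> {}" using verts_nonempty by (simp_all add: H_def)
  define D where "D = Max H"
  have "D \<in> H" unfolding D_def using H by (rule Max_in)
  then obtain u v where uv: "u \<in> verts G" "v \<in> verts G" "hops u v = D"
    by (auto simp: H_def)
  have leD: "hops x y \<le> D" if "x \<in> verts G" "y \<in> verts G" for x y
    unfolding D_def using H(1) by (rule Max_ge) (use that in \<open>force simp: H_def\<close>)
  have "D \<le> 4" using le4 uv by metis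
  show thesis
  proof (cases "D \<le> 2")
    case True
    then show ?thesis using that[OF uv(1)] leD[OF uv(1)] order_trans by blast
  next
    case False
    have closer: "\<exists>y. y \<rightarrow>\<^bsub>G\<^esub> x \<and> hops u x = hops u y + 1" if "hops u x > 0" "x \<in> verts G" for x
    proof -
      have "x \<noteq> u" using that(1) uv(1) by auto
      from hops_parent[OF reach[OF uv(1) that(2)] this] show ?thesis by blast
    qed
    \<comment> \<open>The longest path has length 3 or 4; \<open>x3\<close> is its vertex at distance 3 from \<open>u\<close>,
      which is \<open>v\<close> itself if the length is 3.\<close>
    obtain x3 where x3: "x3 \<in> verts G" "hops u x3 = 3"
      "D = 3 \<or> x3 \<rightarrow>\<^bsub>G\<^esub> v \<and> hops u v = 4 \<and> D = 4"
    proof (cases "D = 3")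
      case True
      then show ?thesis using that[of v] uv by simp
    next
      case False
      with \<open>\<not> D \<le> 2\<close> \<open>D \<le> 4\<close> have "D = 4" by simp
      with closer[OF _ uv(2)] uv(3) obtain y where "y \<rightarrow>\<^bsub>G\<^esub> v" "hops u v = hops u y + 1" by auto
      then show ?thesis using that[of y] \<open>D = 4\<close> uv(3) adj_in_verts(1) by simp
    qed
    obtain c where c: "c \<rightarrow>\<^bsub>G\<^esub> x3" "hops u c = 2"
      using closer[OF _ x3(1)] x3(2) by auto
    have cV: "c \<in> verts G" using c(1) by (rule adj_in_verts)
    obtain x1 where x1: "x1 \<rightarrow>\<^bsub>G\<^esub> c" "hops u x1 = 1"
      using closer[OF _ cV] c(2) by auto
    have x1V: "x1 \<in> verts G" using x1(1) by (rule adj_in_verts)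
    obtain x0 where x0: "x0 \<rightarrow>\<^bsub>G\<^esub> x1" "hops u x0 = 0"
      using closer[OF _ x1V] x1(2) by auto
    have "x0 = u" using hops_eq_0_iff[OF reach[OF uv(1) adj_in_verts(1)[OF x0(1)]]] x0(2) by simp
    with x0(1) have ux1: "x1 \<rightarrow>\<^bsub>G\<^esub> u" by (simp add: adj_sym)
    have "hops w c \<le> 2" if w: "w \<in> verts G" for w
    proof (rule ccontr)
      assume far: "\<not> hops w c \<le> 2"
      show False
      proof (cases "hops w x1 \<le> hops w c")
        case True
        have "x1 \<noteq> x3" using x1(2) x3(2) by auto
        from hops_ascend[OF w x1(1) c(1) this True]
        have x3_far: "hops w x3 = hops w c + 1" .
        show False
        proof (cases "D = 3")
          case True
          with leD[OF w x3(1)] x3_far far show False by simp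
        next
          case False
          with x3(3) have v: "x3 \<rightarrow>\<^bsub>G\<^esub> v" "hops u v = 4" "D = 4" by auto
          have "c \<noteq> v" using c(2) v(2) by auto
          from hops_ascend[OF w c(1) v(1) this] x3_far
          have "hops w v = hops w x3 + 1" by simp
          with leD[OF w uv(2)] x3_far far v(3) show False by simp
        qed
      next
        case False
        have "c \<noteq> u" using c(2) uv(1) by auto
        from hops_ascend[OF w adj_sym[OF x1(1)] ux1 this] False
        have "hops w u = hops w x1 + 1" by simp
        with le4[OF w uv(1)] False far show False by simp
      qed
    qed
    then show ?thesis using that[OF cV] hops_commute[OF reach[OF cV]] by simp
  qed
qed

lemma finite_neighbours: "finite (neighbours v)"
  by (rule finite_subset[OF _ finite_verts]) (auto simp: neighbours_def dest: adj_in_verts)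

text \<open>Without parallel arcs, an arc leaving \<open>v\<close> is determined by its head.\<close>

lemma out_degree_eq_card_neighbours: "out_degree G v = card (neighbours v)"
proof -
  have "inj_on (head G) (out_arcs G v)"
    by (rule inj_onI) (auto simp: arc_to_ends_def intro: no_multi_arcs)
  moreover have "head G ` out_arcs G v = neighbours v"
    by (auto simp: neighbours_def arcs_ends_conv)
  ultimately show ?thesis unfolding out_degree_def by (metis card_image)
qed

end

section \<open>Trees of radius at most two\<close>

locale radius_two_tree = finite_tree +
  fixes c
  assumes center_in_verts: "c \<in> verts G"
    and radius: "w \<in> verts G \<Longrightarrow> hops c w \<le> 2"
begin

lemma hops_center_neighbour:
  assumes "c \<rightarrow>\<^bsub>G\<^esub> v"
  shows "hops c v = 1"
proof -
  have "hops c v \<le> 1"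
    using hops_step_le[OF reach[OF center_in_verts center_in_verts] assms] center_in_verts by simp
  moreover have "hops c v \<noteq> 0"
    using hops_eq_0_iff[OF reachable_adjI[OF assms]] adj_not_same assms by metis
  ultimately show ?thesis by simp
qed

lemma hops_center_child:
  assumes "c \<rightarrow>\<^bsub>G\<^esub> v" "v \<rightarrow>\<^bsub>G\<^esub> x" "x \<noteq> c"
  shows "hops c x = 2"
  using hops_ascend[OF center_in_verts assms(1,2)] assms(3) hops_center_neighbour[OF assms(1)]
    center_in_verts by simp

lemma within_branch:
  assumes "x \<in> verts G" "x \<noteq> c"
  obtains "c \<rightarrow>\<^bsub>G\<^esub> x" | v where "c \<rightarrow>\<^bsub>G\<^esub> v" "v \<rightarrow>\<^bsub>G\<^esub> x"
proof -
  obtain v where v: "v \<rightarrow>\<^bsub>G\<^esub> x" "hops c x = hops c v + 1"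
    using hops_parent[OF reach[OF center_in_verts assms(1)] assms(2)] .
  have vV: "v \<in> verts G" using v(1) by (rule adj_in_verts)
  show thesis
  proof (cases "v = c")
    case True
    with v(1) that(1) show ?thesis by simp
  next
    case False
    obtain u where u: "u \<rightarrow>\<^bsub>G\<^esub> v" "hops c v = hops c u + 1"
      using hops_parent[OF reach[OF center_in_verts vV] False] .
    from radius[OF assms(1)] v(2) u(2) have "hops c u = 0" by simp
    then have "u = c"
      using hops_eq_0_iff[OF reach[OF center_in_verts adj_in_verts(1)[OF u(1)]]] by simp
    with u(1) v(1) that(2) show ?thesis by simp
  qed
qed

text \<open>
  The branch of a neighbour \<open>v\<close> of \<open>c\<close> arises from the neighbourhood of \<open>v\<close> by exchanging \<open>c\<close>
  for \<open>v\<close>, so both have the same size. The branches partition the vertices other than \<open>c\<close>: a vertex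
  in two branches would be at distance 2 from \<open>c\<close> with two neighbours closer to \<open>c\<close>.
\<close>

lemma card_verts_eq: "card (verts G) = 1 + (\<Sum>v\<in>neighbours c. card (neighbours v))"
proof -
  define branch where "branch v = insert v (neighbours v - {c})" for v
  have card_branch: "card (branch v) = card (neighbours v)" if "v \<in> neighbours c" for v
  proof -
    have "c \<in> neighbours v" using that adj_sym by (simp add: neighbours_def)
    moreover have "v \<notin> neighbours v" using adj_not_same by (auto simp: neighbours_def)
    ultimately show ?thesis
      unfolding branch_def
      using card_Suc_Diff1[OF finite_neighbours, of c v]
        card_insert_disjoint[of "neighbours v - {c}" v] finite_neighbours by auto
  qed
  have fin: "finite (branch v)" for v unfolding branch_def using finite_neighbours by simp
  have disj: "branch v \<inter> branch v' = {}"
    if "v \<in> neighbours c" "v' \<in> neighbours c" "v \<noteq> v'" for v v'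
  proof (rule equals0I)
    fix x assume x: "x \<in> branch v \<inter> branch v'"
    have adj: "c \<rightarrow>\<^bsub>G\<^esub> v" "c \<rightarrow>\<^bsub>G\<^esub> v'" using that by (simp_all add: neighbours_def)
    have lev: "hops c v = 1" "hops c v' = 1" using adj by (simp_all add: hops_center_neighbour)
    have child: "hops c x = 2" if "u \<in> neighbours c" "x \<in> neighbours u - {c}" for u
      using hops_center_child[of u x] that by (simp add: neighbours_def)
    from x that lev child have "x \<in> neighbours v - {c}" "x \<in> neighbours v' - {c}"
      unfolding branch_def by fastforce+
    then have up: "x \<rightarrow>\<^bsub>G\<^esub> v" "x \<rightarrow>\<^bsub>G\<^esub> v'" and "hops c x = 2"
      using child that(1) adj_sym by (simp_all add: neighbours_def)
    with unique_lower_neighbour[OF center_in_verts up] lev that(3) show False by simp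
  qed
  have "verts G - {c} = (\<Union>v\<in>neighbours c. branch v)"
  proof (intro equalityI subsetI)
    fix x assume "x \<in> verts G - {c}"
    then have "x \<in> verts G" "x \<noteq> c" by simp_all
    then show "x \<in> (\<Union>v\<in>neighbours c. branch v)"
      by (rule within_branch) (use \<open>x \<noteq> c\<close> in \<open>auto simp: neighbours_def branch_def\<close>)
  next
    fix x assume "x \<in> (\<Union>v\<in>neighbours c. branch v)"
    then obtain v where "c \<rightarrow>\<^bsub>G\<^esub> v" "x = v \<or> v \<rightarrow>\<^bsub>G\<^esub> x \<and> x \<noteq> c"
      by (auto simp: neighbours_def branch_def)
    then show "x \<in> verts G - {c}" using adj_not_same adj_in_verts(2) by blast
  qed
  moreover have "card (\<Union>v\<in>neighbours c. branch v) = (\<Sum>v\<in>neighbours c. card (branch v))"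
    by (rule card_UN_disjoint) (use finite_neighbours fin disj in blast)+
  ultimately have "card (verts G - {c}) = (\<Sum>v\<in>neighbours c. card (neighbours v))"
    using card_branch by simp
  moreover have "card (verts G) = Suc (card (verts G - {c}))"
    using center_in_verts by (simp only: card_Suc_Diff1 finite_verts)
  ultimately show ?thesis by simp
qed

text \<open>
  With at least two branches, one of them is not in the direction of \<open>x\<close>, and distances from \<open>x\<close>
  grow from \<open>c\<close> into that branch down to a leaf. For \<open>x \<noteq> c\<close> this rules out \<open>x\<close> as a centre,
  and for \<open>x\<close> a leaf at distance 2 from \<open>c\<close> it yields a pair of vertices at distance 4.
\<close>

lemma farther_vertex:
  assumes two: "card (neighbours c) \<ge> 2" "\<And>v. v \<in> neighbours c \<Longrightarrow> card (neighbours v) \<ge> 2"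
    and x: "x \<in> verts G"
  obtains y where "y \<in> verts G" "hops x y = hops x c + 2"
proof -
  have "\<exists>v\<in>neighbours c. \<not> hops x v \<le> hops x c"
  proof (rule ccontr)
    assume "\<not> ?thesis"
    then have "v = v'" if "v \<in> neighbours c" "v' \<in> neighbours c" for v v'
      using unique_lower_neighbour[OF x, of c v v'] that by (simp add: neighbours_def)
    then have "card (neighbours c) \<le> Suc 0"
      using card_le_Suc0_iff_eq[OF finite_neighbours] by blast
    with two(1) show False by simp
  qed
  then obtain v where v: "c \<rightarrow>\<^bsub>G\<^esub> v" "hops x v > hops x c" by (auto simp: neighbours_def)
  have "\<not> neighbours v \<subseteq> {c}"
  proof
    assume "neighbours v \<subseteq> {c}"
    then have "card (neighbours v) \<le> 1" using card_mono[of "{c}"] by fastforce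
    with two(2)[of v] v(1) show False by (simp add: neighbours_def)
  qed
  then obtain y where y: "v \<rightarrow>\<^bsub>G\<^esub> y" "y \<noteq> c" by (auto simp: neighbours_def)
  have "hops x y = hops x v + 1"
    using hops_ascend[OF x v(1) y(1)] y(2) v(2) by simp
  moreover have "hops x v \<le> hops x c + 1"
    using hops_step_le[OF reach[OF x center_in_verts] v(1)] .
  ultimately have "hops x y = hops x c + 2" using v(2) by simp
  then show thesis using that adj_in_verts(2)[OF y(1)] by simp
qed

end

section \<open>Acquisition moves\<close>

text \<open>
  Vertices of weight 1 can give their units to any neighbours of positive weight. No target lies
  in \<open>L\<close>, so targets only gain weight and the vertices of \<open>L\<close> can move in any order.
\<close>

lemma unit_acquisition_gather:
  assumes "finite L"
    and "\<And>x. x \<in> L \<Longrightarrow> x \<rightarrow>\<^bsub>G\<^esub> f x \<and> f x \<notin> L \<and> w x = 1 \<and> w (f x) \<ge> 1"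
  shows "\<exists>w'. (unit_acquisition_move G)\<^sup>*\<^sup>* w w' \<and> (\<forall>x\<in>L. w' x = 0) \<and>
    (\<forall>x. x \<notin> L \<union> f ` L \<longrightarrow> w' x = w x)"
  using assms
proof (induction L arbitrary: w rule: finite_induct)
  case empty
  then show ?case by blast
next
  case (insert a L)
  define w1 where "w1 = w(a := 0, f a := w (f a) + 1)"
  have a: "a \<rightarrow>\<^bsub>G\<^esub> f a" "f a \<notin> insert a L" "w a = 1" "w (f a) \<ge> 1"
    using insert.prems[of a] by simp_all
  have "unit_acquisition_move G w w1"
    unfolding unit_acquisition_move_def w1_def
    by (rule exI[of _ a], rule exI[of _ "f a"]) (use a in simp)
  moreover have "x \<rightarrow>\<^bsub>G\<^esub> f x \<and> f x \<notin> L \<and> w1 x = 1 \<and> w1 (f x) \<ge> 1" if "x \<in> L" for x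
    using insert.prems[of x] that insert.hyps(2) a(2) by (auto simp: w1_def)
  from insert.IH[OF this] obtain w' where w': "(unit_acquisition_move G)\<^sup>*\<^sup>* w1 w'"
    "\<forall>x\<in>L. w' x = 0" "\<forall>x. x \<notin> L \<union> f ` L \<longrightarrow> w' x = w1 x" by blast
  ultimately have "(unit_acquisition_move G)\<^sup>*\<^sup>* w w'" by (simp add: converse_rtranclp_into_rtranclp)
  moreover have "w' a = 0"
  proof -
    have "a \<notin> f ` L" using insert.prems by blast
    then have "w' a = w1 a" using w'(3) insert.hyps(2) by blast
    then show ?thesis using a(2) by (auto simp: w1_def)
  qed
  moreover have "w' x = w x" if "x \<notin> insert a L \<union> f ` insert a L" for x
    using w'(3) that by (simp add: w1_def)
  ultimately show ?case using w'(2) by (intro exI[of _ w']) simp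
qed

text \<open>
  A unit travels from \<open>x\<close> to \<open>c\<close> through an intermediate vertex \<open>f x\<close> of weight 1, which grows to
  weight 2 and returns to weight 1 when it passes one unit on. The second move is legal because \<open>c\<close>
  has weight at least 2. As \<open>f x\<close> ends as it began, it can serve any number of vertices.
\<close>

lemma unit_acquisition_relay:
  assumes "finite L" and "w c \<ge> 2" and "c \<notin> L"
    and "\<And>x. x \<in> L \<Longrightarrow> x \<rightarrow>\<^bsub>G\<^esub> f x \<and> f x \<rightarrow>\<^bsub>G\<^esub> c \<and> f x \<notin> insert c L \<and> w x = 1 \<and> w (f x) = 1"
  shows "\<exists>w'. (unit_acquisition_move G)\<^sup>*\<^sup>* w w' \<and> (\<forall>x\<in>L. w' x = 0) \<and> w' c \<ge> 2 \<and>
    (\<forall>x. x \<notin> insert c L \<longrightarrow> w' x = w x)"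
  using assms
proof (induction L arbitrary: w rule: finite_induct)
  case empty
  then show ?case by blast
next
  case (insert a L)
  define w1 where "w1 = w(a := 0, f a := 2)"
  define w2 where "w2 = w(a := 0, c := w c + 1)"
  have a: "a \<rightarrow>\<^bsub>G\<^esub> f a" "f a \<rightarrow>\<^bsub>G\<^esub> c" "f a \<noteq> c" "f a \<noteq> a" "w a = 1" "w (f a) = 1" "a \<noteq> c"
    using insert.prems(2) insert.prems(3)[of a] by auto
  have "unit_acquisition_move G w w1"
    unfolding unit_acquisition_move_def w1_def
    by (rule exI[of _ a], rule exI[of _ "f a"]) (use a in \<open>simp add: numeral_2_eq_2\<close>)
  moreover have "unit_acquisition_move G w1 w2"
    unfolding unit_acquisition_move_def
    by (rule exI[of _ "f a"], rule exI[of _ c])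
      (use a insert.prems(1) in \<open>auto simp: w1_def w2_def fun_eq_iff\<close>)
  moreover have "w2 c \<ge> 2" "c \<notin> L" using insert.prems(1,2) by (simp_all add: w2_def)
  moreover have "x \<rightarrow>\<^bsub>G\<^esub> f x \<and> f x \<rightarrow>\<^bsub>G\<^esub> c \<and> f x \<notin> insert c L \<and> w2 x = 1 \<and> w2 (f x) = 1"
    if "x \<in> L" for x
    using insert.prems(2) insert.prems(3)[of x] that insert.hyps(2) by (auto simp: w2_def)
  note insert.IH[OF calculation(3,4) this]
  then obtain w' where w': "(unit_acquisition_move G)\<^sup>*\<^sup>* w2 w'"
    "\<forall>x\<in>L. w' x = 0" "w' c \<ge> 2" "\<forall>x. x \<notin> insert c L \<longrightarrow> w' x = w2 x" by blast
  ultimately have "(unit_acquisition_move G)\<^sup>*\<^sup>* w w'" by (simp add: converse_rtranclp_into_rtranclp)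
  moreover have "w' a = 0" using w'(4) insert.hyps(2) a(7) by (simp add: w2_def)
  moreover have "w' x = w x" if "x \<notin> insert c (insert a L)" for x
    using w'(4) that by (simp add: w2_def)
  ultimately show ?case using w'(2,3) by (intro exI[of _ w']) simp
qed

lemma unit_acquisition_number_le:
  assumes "(unit_acquisition_move G)\<^sup>*\<^sup>* (\<lambda>_. 1) w" "finite S" "{v \<in> verts G. 0 < w v} \<subseteq> S"
  shows "unit_acquisition_number G \<le> card S"
proof -
  have "unit_acquisition_number G \<le> card {v \<in> verts G. 0 < w v}"
    unfolding unit_acquisition_number_def by (rule Least_le) (use assms(1) in blast)
  also have "\<dots> \<le> card S" using assms(2,3) by (rule card_mono)
  finally show ?thesis .
qed

text \<open>After a move its target has positive weight, so the weight never dies out.\<close>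

lemma (in fin_digraph) unit_acquisition_number_pos:
  assumes "verts G \<noteq> {}"
  shows "0 < unit_acquisition_number G"
proof -
  have pos: "\<exists>v\<in>verts G. 0 < w v" if "(unit_acquisition_move G)\<^sup>*\<^sup>* (\<lambda>_. 1) w" for w
    using that
  proof (induction rule: rtranclp_induct)
    case base
    then show ?case using assms by auto
  next
    case (step w w')
    then obtain u v where "u \<rightarrow>\<^bsub>G\<^esub> v" "w' = w(u := w u - 1, v := w v + 1)"
      unfolding unit_acquisition_move_def by blast
    then show ?case using adj_in_verts(2) by (intro bexI[of _ v]) simp_all
  qed
  have "\<exists>w. (unit_acquisition_move G)\<^sup>*\<^sup>* (\<lambda>_. 1) w \<and>
      card {v \<in> verts G. 0 < w v} = unit_acquisition_number G"
    unfolding unit_acquisition_number_def by (rule LeastI_ex) blast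
  then obtain w where w: "(unit_acquisition_move G)\<^sup>*\<^sup>* (\<lambda>_. 1) w"
    "card {v \<in> verts G. 0 < w v} = unit_acquisition_number G" by blast
  from pos[OF w(1)] have "card {v \<in> verts G. 0 < w v} > 0"
    by (auto simp: card_gt_0_iff)
  with w(2) show ?thesis by simp
qed

section \<open>Two acquisition strategies around the centre\<close>

context radius_two_tree
begin

lemma branch_root:
  shows "\<exists>f. \<forall>x\<in>verts G - insert c (neighbours c). c \<rightarrow>\<^bsub>G\<^esub> f x \<and> x \<rightarrow>\<^bsub>G\<^esub> f x"
proof -
  have "\<exists>v. c \<rightarrow>\<^bsub>G\<^esub> v \<and> x \<rightarrow>\<^bsub>G\<^esub> v" if "x \<in> verts G - insert c (neighbours c)" for x
  proof -
    from that have x: "x \<in> verts G" "x \<noteq> c" "\<not> c \<rightarrow>\<^bsub>G\<^esub> x" by (simp_all add: neighbours_def)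
    from x(1,2) show ?thesis
    proof (cases rule: within_branch)
      case 1
      with x(3) show ?thesis by blast
    next
      case (2 v)
      then show ?thesis using adj_sym[OF 2(2)] by blast
    qed
  qed
  then show ?thesis by metis
qed

text \<open>
  Each vertex at distance 2 from \<open>c\<close> moves to its branch root and \<open>c\<close> itself moves to an arbitrary
  neighbour; only neighbours of \<open>c\<close> keep weight.
\<close>

lemma unit_acquisition_number_le_center_degree:
  assumes "neighbours c \<noteq> {}"
  shows "unit_acquisition_number G \<le> card (neighbours c)"
proof -
  obtain v where v: "c \<rightarrow>\<^bsub>G\<^esub> v" using assms by (auto simp: neighbours_def)
  obtain f where f: "\<And>x. x \<in> verts G - insert c (neighbours c) \<Longrightarrow> c \<rightarrow>\<^bsub>G\<^esub> f x \<and> x \<rightarrow>\<^bsub>G\<^esub> f x"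
    using branch_root by metis
  define L where "L = verts G - neighbours c"
  have step: "x \<rightarrow>\<^bsub>G\<^esub> (f(c := v)) x \<and> (f(c := v)) x \<notin> L" if "x \<in> L" for x
    using f[of x] that v by (cases "x = c") (simp_all add: L_def neighbours_def)
  have "finite L" by (simp add: L_def)
  from unit_acquisition_gather[OF this, where G = G and f = "f(c := v)" and w = "\<lambda>_. 1"] step
  obtain w where w: "(unit_acquisition_move G)\<^sup>*\<^sup>* (\<lambda>_. 1) w" "\<forall>x\<in>L. w x = 0" by auto
  from w(2) have "{x \<in> verts G. 0 < w x} \<subseteq> neighbours c" by (force simp: L_def)
  from unit_acquisition_number_le[OF w(1) finite_neighbours this] show ?thesis .
qed

text \<open>
  The unit of \<open>v\<close> raises \<open>c\<close> to weight 2 (\<open>w1\<close>), which enables relaying the units of all leaves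
  of the other branches to \<open>c\<close> (\<open>w2\<close>); then the roots of these branches give their own units to
  \<open>c\<close> (\<open>w3\<close>). The leaves behind \<open>v\<close> are stranded. They and \<open>c\<close> are the neighbours of \<open>v\<close>.
\<close>

lemma unit_acquisition_number_le_neighbour_degree:
  assumes v: "v \<in> neighbours c"
  shows "unit_acquisition_number G \<le> card (neighbours v)"
proof -
  let ?R = "unit_acquisition_move G"
  have cv: "c \<rightarrow>\<^bsub>G\<^esub> v" using v by (simp add: neighbours_def)
  have no_loop: "\<not> x \<rightarrow>\<^bsub>G\<^esub> x" for x using adj_not_same by blast
  have "c \<noteq> v" using cv no_loop by metis
  obtain f where f: "\<And>x. x \<in> verts G - insert c (neighbours c) \<Longrightarrow> c \<rightarrow>\<^bsub>G\<^esub> f x \<and> x \<rightarrow>\<^bsub>G\<^esub> f x"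
    using branch_root by metis
  define w1 :: "'a \<Rightarrow> nat" where "w1 = (\<lambda>_. 1)(v := 0, c := 2)"
  have "?R (\<lambda>_. 1) w1"
    unfolding unit_acquisition_move_def w1_def
    by (rule exI[of _ v], rule exI[of _ c]) (use adj_sym[OF cv] in \<open>simp add: numeral_2_eq_2\<close>)
  then have w1: "?R\<^sup>*\<^sup>* (\<lambda>_. 1) w1" by blast
  define L where "L = verts G - insert c (neighbours c) - neighbours v"
  have relay: "x \<rightarrow>\<^bsub>G\<^esub> f x \<and> f x \<rightarrow>\<^bsub>G\<^esub> c \<and> f x \<notin> insert c L \<and> w1 x = 1 \<and> w1 (f x) = 1"
    if "x \<in> L" for x
  proof -
    have x: "x \<noteq> c" "\<not> c \<rightarrow>\<^bsub>G\<^esub> x" "\<not> v \<rightarrow>\<^bsub>G\<^esub> x" and fx: "c \<rightarrow>\<^bsub>G\<^esub> f x" "x \<rightarrow>\<^bsub>G\<^esub> f x"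
      using that f[of x] by (simp_all add: L_def neighbours_def)
    have "f x \<noteq> v" using adj_sym[OF fx(2)] x(3) by metis
    moreover have "f x \<noteq> c" using fx(1) no_loop by metis
    moreover have "x \<noteq> v" using cv x(2) by metis
    ultimately show ?thesis
      using fx adj_sym[OF fx(1)] x(1) by (simp add: w1_def L_def neighbours_def)
  qed
  have "finite L" "w1 c \<ge> 2" "c \<notin> L" by (simp_all add: L_def w1_def)
  from unit_acquisition_relay[OF this relay] obtain w2 where w2: "?R\<^sup>*\<^sup>* w1 w2"
    "\<forall>x\<in>L. w2 x = 0" "w2 c \<ge> 2" "\<forall>x. x \<notin> insert c L \<longrightarrow> w2 x = w1 x" by blast
  define M where "M = neighbours c - {v}"
  have "finite M" using finite_neighbours by (simp add: M_def)
  moreover have "x \<rightarrow>\<^bsub>G\<^esub> c \<and> c \<notin> M \<and> w2 x = 1 \<and> w2 c \<ge> 1" if "x \<in> M" for x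
  proof -
    from that have x: "c \<rightarrow>\<^bsub>G\<^esub> x" "x \<noteq> v" by (simp_all add: M_def neighbours_def)
    have "x \<noteq> c" using x(1) no_loop by metis
    moreover have "x \<notin> L" using x(1) by (simp add: L_def neighbours_def)
    ultimately have "w2 x = 1" using w2(4) x(2) by (simp add: w1_def)
    then show ?thesis using adj_sym[OF x(1)] w2(3) no_loop by (simp add: M_def neighbours_def)
  qed
  ultimately obtain w3 where w3: "?R\<^sup>*\<^sup>* w2 w3" "\<forall>x\<in>M. w3 x = 0"
    "\<forall>x. x \<notin> M \<union> (\<lambda>_. c) ` M \<longrightarrow> w3 x = w2 x"
    using unit_acquisition_gather[where L = M and G = G and f = "\<lambda>_. c" and w = w2] by blast
  have "w3 x = 0" if "x \<in> verts G" "x \<notin> neighbours v" for x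
  proof -
    have "x \<noteq> c" using that(2) adj_sym[OF cv] by (auto simp: neighbours_def)
    show ?thesis
    proof (cases "x \<in> M")
      case True
      then show ?thesis using w3(2) by simp
    next
      case False
      then have "w3 x = w2 x" using w3(3) \<open>x \<noteq> c\<close> by blast
      also have "w2 x = 0"
      proof (cases "x = v")
        case True
        then have "x \<notin> L" using v by (simp add: L_def)
        then show ?thesis using w2(4) True \<open>x \<noteq> c\<close> by (simp add: w1_def)
      next
        case x_not_v: False
        with False that \<open>x \<noteq> c\<close> have "x \<in> L" by (simp add: L_def M_def)
        then show ?thesis using w2(2) by simp
      qed
      finally show ?thesis .
    qed
  qed
  then have "{x \<in> verts G. 0 < w3 x} \<subseteq> neighbours v" by force
  moreover have "?R\<^sup>*\<^sup>* (\<lambda>_. 1) w3" using w1 w2(1) w3(1) by (meson rtranclp_trans)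
  ultimately show ?thesis using unit_acquisition_number_le finite_neighbours by metis
qed

end

section \<open>The bounds and the case of equality\<close>

theorem proposition2p9:
  fixes T :: "('a, 'b) pre_digraph" and n :: nat
  assumes "undirected_tree T"
    and "n = card (verts T)"
    and "graph_diameter T \<le> 4"
  shows "(n \<ge> 2 \<longrightarrow> real (unit_acquisition_number T) \<le> sqrt (real n - 1))
    \<and> sqrt (real n - 1) \<le> real (max_degree T)
    \<and> (n \<noteq> 2 \<longrightarrow> real (unit_acquisition_number T) = sqrt (real n - 1) \<longrightarrow>
         (\<exists>k::nat. n - 1 = k\<^sup>2) \<and> graph_diameter T = 4 \<and>
         (\<exists>c. central_vertex T c \<and> real (out_degree T c) = sqrt (real n - 1) \<and>
            (\<forall>v. c \<rightarrow>\<^bsub>T\<^esub> v \<longrightarrow> real (out_degree T v) = sqrt (real n - 1))))"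
proof -
  from assms(1) interpret graph T by (simp add: undirected_tree_def)
  interpret finite_tree T
    by unfold_locales (use assms(1) in \<open>simp_all add: undirected_tree_def\<close>)
  have dist: "graph_dist T u v = ereal (real (hops u v))" if "u \<in> verts T" "v \<in> verts T" for u v
    using graph_dist_eq_hops[OF reach[OF that]] .
  have dist_le: "graph_dist T u v \<le> graph_diameter T" if "u \<in> verts T" "v \<in> verts T" for u v
    unfolding graph_diameter_def using that by (meson SUP_upper order_trans)
  have "hops u v \<le> 4" if "u \<in> verts T" "v \<in> verts T" for u v
    using order_trans[OF dist_le[OF that] assms(3)] dist[OF that] by simp
  then obtain c where c: "c \<in> verts T" "\<And>w. w \<in> verts T \<Longrightarrow> hops c w \<le> 2"
    using exists_center by metis
  interpret radius_two_tree T c by unfold_locales (fact c)+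
  let ?a = "unit_acquisition_number T"
  let ?N = "neighbours c"
  have n: "n = 1 + (\<Sum>v\<in>?N. card (neighbours v))" using card_verts_eq assms(2) by simp
  then have n_ge_1: "1 \<le> n" by simp
  have a_pos: "0 < ?a" using unit_acquisition_number_pos verts_nonempty .
  have a_le: "?a \<le> card (neighbours v)" if "v \<in> ?N" for v
    using unit_acquisition_number_le_neighbour_degree that .
  have bound: "card ?N * ?a \<le> n - 1"
    using sum_bounded_below[of ?N ?a "\<lambda>v. card (neighbours v)"] a_le n by simp
  have a_le_c: "?a \<le> card ?N" if "n \<ge> 2"
    by (rule unit_acquisition_number_le_center_degree) (use that n in auto)

  have first: "real ?a \<le> sqrt (real n - 1)" if "n \<ge> 2"
  proof -
    have "?a\<^sup>2 \<le> n - 1"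
      unfolding power2_eq_square using mult_le_mono1[OF a_le_c[OF that]] bound by (rule order_trans)
    then have "(real ?a)\<^sup>2 \<le> real n - 1" using that by (simp flip: of_nat_power)
    then show ?thesis by (rule real_le_rsqrt)
  qed

  have second: "sqrt (real n - 1) \<le> real (max_degree T)"
  proof -
    have deg: "card (neighbours v) \<le> max_degree T" if "v \<in> verts T" for v
      unfolding max_degree_def using that
      by (intro Max_ge) (auto simp flip: out_degree_eq_card_neighbours)
    have "?N \<subseteq> verts T" by (auto simp: neighbours_def dest: adj_in_verts)
    then have "n - 1 \<le> card ?N * max_degree T"
      using sum_bounded_above[of ?N "\<lambda>v. card (neighbours v)" "max_degree T"] deg n by auto
    also have "\<dots> \<le> (max_degree T)\<^sup>2" using deg[OF c(1)] by (simp add: power2_eq_square)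
    finally have "real (n - 1) \<le> (real (max_degree T))\<^sup>2" by (simp flip: of_nat_power)
    then show ?thesis using n by (intro real_le_lsqrt) simp_all
  qed

  have third: "(\<exists>k::nat. n - 1 = k\<^sup>2) \<and> graph_diameter T = 4 \<and>
      (\<exists>c. central_vertex T c \<and> real (out_degree T c) = sqrt (real n - 1) \<and>
        (\<forall>v. c \<rightarrow>\<^bsub>T\<^esub> v \<longrightarrow> real (out_degree T v) = sqrt (real n - 1)))"
    if "n \<noteq> 2" and eq: "real ?a = sqrt (real n - 1)"
  proof -
    have "real n - 1 = (real ?a)\<^sup>2" using eq n_ge_1 by simp
    then have "real n = real (1 + ?a\<^sup>2)" by simp
    then have square: "n = 1 + ?a\<^sup>2" by (simp only: of_nat_eq_iff)
    with a_pos have "n \<ge> 2" by (simp add: Suc_le_eq)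
    \<comment> \<open>A star has \<open>a = 1\<close>, which is \<open>sqrt (n - 1)\<close> only for a single edge.\<close>
    have "?a \<noteq> 1" using square \<open>n \<noteq> 2\<close> by auto
    with a_pos have two: "?a \<ge> 2" by simp
    have deg_c: "card ?N = ?a"
      using bound a_le_c[OF \<open>n \<ge> 2\<close>] square a_pos by (simp add: power2_eq_square)
    have deg: "card (neighbours v) = ?a" if v: "v \<in> ?N" for v
    proof (rule ccontr)
      assume "card (neighbours v) \<noteq> ?a"
      with a_le[OF v] have "?a < card (neighbours v)" by simp
      then have "(\<Sum>v\<in>?N. ?a) < (\<Sum>v\<in>?N. card (neighbours v))"
        using v a_le finite_neighbours by (intro sum_strict_mono_ex1) auto
      then show False using square n deg_c by (simp add: power2_eq_square)
    qed
    have far: "\<exists>y\<in>verts T. hops x y = hops x c + 2" if "x \<in> verts T" for x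
      using farther_vertex[OF _ _ that] two deg_c deg by metis
    obtain y where y: "y \<in> verts T" "hops c y = 2" using far[OF c(1)] c(1) by auto
    obtain z where z: "z \<in> verts T" "hops y z = 4"
      using far[OF y(1)] hops_commute[OF reach[OF c(1) y(1)]] y(2) by auto
    have "graph_diameter T = 4"
      using dist_le[OF y(1) z(1)] dist[OF y(1) z(1)] z(2) assms(3) by (intro antisym) simp_all
    moreover have "central_vertex T c"
      unfolding central_vertex_def
    proof (intro allI iffI)
      fix x assume x: "x \<in> verts T \<and> (\<forall>v\<in>verts T. graph_dist T x v \<le> 2)"
      then obtain y where y: "y \<in> verts T" "hops x y = hops x c + 2" using far by blast
      with x have "hops x c = 0" using dist[of x y] by auto
      then show "x = c" using hops_eq_0_iff[OF reach] x c(1) by blast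
    next
      fix x assume "x = c"
      then show "x \<in> verts T \<and> (\<forall>v\<in>verts T. graph_dist T x v \<le> 2)"
        using c dist[OF c(1)] by simp
    qed
    moreover have "\<exists>k::nat. n - 1 = k\<^sup>2" using square by (intro exI[of _ ?a]) simp
    ultimately show ?thesis
      using deg deg_c eq by (auto simp: out_degree_eq_card_neighbours neighbours_def)
  qed
  show ?thesis using first second third by blast
qed

end
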